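(* Consider $U_q^-(\mathfrak{sl}_3)$. Let $b$ and $k$ be fixed non-negative integers. For integers $s$ and $t$ such that $0\le t\le s\le\min\{b,k\}$, setting $\underline a=(k-s,b,s)$ and $\underline{a'}=(k-t,b,t)$, we have $$n_{\underline{a'}}(\underline a)=q^{(s-t)(b-t)}\begin{bmatrix}k-t\\ s-t\end{bmatrix}.$$
   Context: Here $\mathfrak g=\mathfrak{sl}_3(\mathbb C)$, with simple roots $\alpha_1,\alpha_2$. $[j]=\frac{q^j-q^{-j}}{q-q^{-1}}$, $[j]!=[1][2]\cdots[j]$, and $\begin{bmatrix}p\\ j\end{bmatrix}=\frac{[p]!}{[j]!\,[p-j]!}$ for $0\le j\le p$. $F_i^{(j)}=F_i^j/[j]!$. **Tableaux.** For non-negative integers $m_1,m_2$, the shape $\lambda=(m_1,m_2)$ has $m_1+m_2$ top-justified columns, numbered from left to right, the first $m_1$ with one box and the next $m_2$ with two boxes. A tableau of shape $\lambda$ is a filling by entries in $\{1,2,3\}$ strictly increasing down columns; it is standard if entries in each row are non-increasing from left to right. A standard monomial is a triple $\underline a=(a,b,c)$ of integers with $a\ge0$, $b\ge c\ge0$. A standard tableau $\sigma$ has associated standard monomial $(a,b,c)$, where $a$ is the number of 2's in the first row, $b$ is the total number of 3's, and $c$ is the number of 3's in the first row. A tableau is special if every entry on row $r$ that is greater than $r$ is the last entry in its column. If $m_1\ge a+c$ and $m_2\ge b-c$ there is a unique special standard tableau of shape $\lambda$ with associated monomial $(a,b,c)$. **Modules.** $U_q(\mathfrak{sl}_3)$ is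 the $\mathbb Q(q)$-algebra with usual generators $E_i,F_i,K_i^{\pm1}$ ($i=1,2$). $V(j)$ ($j=1,2$) is the fundamental module with basis $v_x$, $x$ running over single-column tableaux with $j$ boxes: for each $i$, $F_iv_x=v_z$, with $z$ obtained by replacing $i$ by $i+1$, if $i$ but not $i+1$ occurs in $x$, and $F_iv_x=0$ otherwise; $K_iv_x$ equals $qv_x$, $q^{-1}v_x$, $v_x$ according as only $i$ occurs, only $i+1$ occurs, or both or neither occur. $v_1$ and $v_2$ are the basis vectors for the columns $(1)$ and $(1,2)$. Tensor products are formed using the comultiplication $\Delta'(F_i)=F_i\otimes1+K_i\otimes F_i$, $\Delta'(K_i)=K_i\otimes K_i$. Put $V=V(1)^{\otimes m_1}\otimes V(2)^{\otimes m_2}$, $v_\lambda=v_1^{\otimes m_1}\otimes v_2^{\otimes m_2}$; for a tableau $x$ of shape $\lambda$ with columns $x_1,x_2,\dots$ put $v_x=v_{x_1}\otimes v_{x_2}\otimes\cdots$. The $v_x$ form a basis of $V$. **The coefficients.** For standard monomials $\underline a=(a,b,c)$ and $\underline{a'}=(a',b',c')$ of the same weight (i.e. $b=b'$, $a+c=a'+c'$), $n_{\underline{a'}}(\underline a)$ denotes the coefficient of $v_\theta$ in the expansion of $F_1^{(a)}F_2^{(b)}F_1^{(c)}v_\lambda$ in the basis $\{v_x\}$, where $\theta$ is the special standard tableau of shape $\lambda=(m_1,m_2)$ with associated monomial $\underline{a'}$, and $\lambda$ is large enough: $m_1\ge a+c$, $m_2\ge b-c$ and $m_2\ge b'-c'$.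 This coefficient does not depend on the choice of such $\lambda$. *)

theory Defs
  imports
    "HOL-Library.Poly_Mapping"
    "HOL-Computational_Algebra.Polynomial"
    "HOL-Computational_Algebra.Fraction_Field"
begin

section \<open>The field \<open>\<rat>(q)\<close> and quantum integers\<close>

type_synonym ratfun = "rat poly fract"

definition q :: ratfun where
  "q = Fract [:0, 1:] 1"

definition qint :: "nat \<Rightarrow> ratfun" where
  "qint j = (q ^ j - inverse q ^ j) / (q - inverse q)"

definition qfact :: "nat \<Rightarrow> ratfun" where
  "qfact p = (\<Prod>j = 1..p. qint j)"

text \<open>Only meaningful for \<open>j \<le> p\<close>, as the subtraction is truncated.\<close>

definition qbinom :: "nat \<Rightarrow> nat \<Rightarrow> ratfun" where
  "qbinom p j = qfact p / (qfact j * qfact (p - j))"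


section \<open>Vector spaces with a given basis\<close>

text \<open>The \<open>\<rat>(q)\<close>-vector space with basis \<^typ>\<open>'x\<close> is \<open>'x \<Rightarrow>\<^sub>0 ratfun\<close>;
  \<open>lookup u x\<close> is the coefficient of \<open>basis x\<close> in \<open>u\<close>.\<close>

definition basis :: "'x \<Rightarrow> ('x \<Rightarrow>\<^sub>0 ratfun)" where
  "basis x = Poly_Mapping.single x 1"

definition scale :: "ratfun \<Rightarrow> ('x \<Rightarrow>\<^sub>0 ratfun) \<Rightarrow> ('x \<Rightarrow>\<^sub>0 ratfun)" where
  "scale c u = Poly_Mapping.map ((*) c) u"

definition lin_ext :: "('x \<Rightarrow> ('y \<Rightarrow>\<^sub>0 ratfun)) \<Rightarrow> ('x \<Rightarrow>\<^sub>0 ratfun) \<Rightarrow> ('y \<Rightarrow>\<^sub>0 ratfun)" where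
  "lin_ext f u = (\<Sum>x\<in>Poly_Mapping.keys u. scale (Poly_Mapping.lookup u x) (f x))"


section \<open>Tableaux\<close>

text \<open>A column is the list of its entries from top to bottom, a tableau the list of its columns
  from left to right. Indices start at \<open>0\<close>, so index \<open>r\<close> in a column is row \<open>r + 1\<close>.\<close>

type_synonym col = "nat list"
type_synonym tableau = "col list"
type_synonym shape = "nat \<times> nat"
type_synonym monomial = "nat \<times> nat \<times> nat"

definition is_tableau :: "shape \<Rightarrow> tableau \<Rightarrow> bool" where
  "is_tableau = (\<lambda>(m1, m2) T.
     length T = m1 + m2 \<and>
     (\<forall>i < m1 + m2. length (T ! i) = (if i < m1 then 1 else 2)) \<and>
     (\<forall>x \<in> set T. set x \<subseteq> {1, 2, 3} \<and> sorted_wrt (<) x))"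

definition standard :: "tableau \<Rightarrow> bool" where
  "standard T \<longleftrightarrow> (\<forall>i j r. i < j \<and> j < length T \<and> r < length (T ! i) \<and> r < length (T ! j)
     \<longrightarrow> T ! j ! r \<le> T ! i ! r)"

definition special :: "tableau \<Rightarrow> bool" where
  "special T \<longleftrightarrow> (\<forall>x \<in> set T. \<forall>r < length x. x ! r > r + 1 \<longrightarrow> r = length x - 1)"

definition assoc_monomial :: "tableau \<Rightarrow> monomial" where
  "assoc_monomial T =
     (card {i. i < length T \<and> T ! i ! 0 = 2},
      card {(i, r). i < length T \<and> r < length (T ! i) \<and> T ! i ! r = 3},
      card {i. i < length T \<and> T ! i ! 0 = 3})"

definition large_enough :: "shape \<Rightarrow> monomial \<Rightarrow> bool" where
  "large_enough = (\<lambda>(m1, m2) (a, b, c). m1 \<ge> a + c \<and> m2 \<ge> b - c)"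

definition theta :: "shape \<Rightarrow> monomial \<Rightarrow> tableau" where
  "theta lam a = (THE T. is_tableau lam T \<and> standard T \<and> special T \<and> assoc_monomial T = a)"


section \<open>The module \<open>V(1)\<^sup>\<otimes>\<^sup>m\<^sup>1 \<otimes> V(2)\<^sup>\<otimes>\<^sup>m\<^sup>2\<close>\<close>

definition F_col :: "nat \<Rightarrow> col \<Rightarrow> (col \<Rightarrow>\<^sub>0 ratfun)" where
  "F_col i x = (if i \<in> set x \<and> i + 1 \<notin> set x
     then basis (map (\<lambda>y. if y = i then i + 1 else y) x) else 0)"

definition K_col :: "nat \<Rightarrow> col \<Rightarrow> (col \<Rightarrow>\<^sub>0 ratfun)" where
  "K_col i x = scale
     (if i \<in> set x \<and> i + 1 \<notin> set x then q
      else if i \<notin> set x \<and> i + 1 \<in> set x then inverse q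
      else 1) (basis x)"

text \<open>\<open>v\<^bsub>x\<^sub>1\<^esub> \<otimes> v\<^bsub>x\<^sub>2\<^esub> \<otimes> \<dots>\<close> is \<open>basis [x\<^sub>1, x\<^sub>2, \<dots>]\<close>; the module of shape
  \<open>(m\<^sub>1, m\<^sub>2)\<close> is the span of the \<open>basis T\<close> with \<open>T\<close> a tableau of that shape.\<close>

definition tensor :: "(col \<Rightarrow>\<^sub>0 ratfun) \<Rightarrow> (tableau \<Rightarrow>\<^sub>0 ratfun) \<Rightarrow> (tableau \<Rightarrow>\<^sub>0 ratfun)" where
  "tensor u w = lin_ext (\<lambda>x. lin_ext (\<lambda>xs. basis (x # xs)) w) u"

text \<open>The action through the iterated comultiplication
  \<open>\<Delta>'(F\<^sub>i) = F\<^sub>i \<otimes> 1 + K\<^sub>i \<otimes> F\<^sub>i\<close>, splitting off the leftmost factor; the empty product is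
  the trivial module, where \<open>F\<^sub>i\<close> acts by \<open>0\<close>.\<close>

fun F_tab :: "nat \<Rightarrow> tableau \<Rightarrow> (tableau \<Rightarrow>\<^sub>0 ratfun)" where
  "F_tab i [] = 0"
| "F_tab i (x # xs) = tensor (F_col i x) (basis xs) + tensor (K_col i x) (F_tab i xs)"

definition F :: "nat \<Rightarrow> (tableau \<Rightarrow>\<^sub>0 ratfun) \<Rightarrow> (tableau \<Rightarrow>\<^sub>0 ratfun)" where
  "F i = lin_ext (F_tab i)"

definition F_div :: "nat \<Rightarrow> nat \<Rightarrow> (tableau \<Rightarrow>\<^sub>0 ratfun) \<Rightarrow> (tableau \<Rightarrow>\<^sub>0 ratfun)" where
  "F_div i j u = scale (1 / qfact j) ((F i ^^ j) u)"

definition v_lam :: "shape \<Rightarrow> (tableau \<Rightarrow>\<^sub>0 ratfun)" where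
  "v_lam = (\<lambda>(m1, m2). basis (replicate m1 [1] @ replicate m2 [1, 2]))"

text \<open>\<open>n_coeff lam a' a\<close> is \<open>n\<^bsub>a'\<^esub>(a)\<close> computed in shape \<open>lam\<close>.\<close>

definition n_coeff :: "shape \<Rightarrow> monomial \<Rightarrow> monomial \<Rightarrow> ratfun" where
  "n_coeff lam a' = (\<lambda>(a, b, c).
     Poly_Mapping.lookup (F_div 1 a (F_div 2 b (F_div 1 c (v_lam lam)))) (theta lam a'))"

end

(* A divided power F_i^(n) acts on x (x) w, for a single column x, by a power of q times
   x (x) F_i^(n) w, plus F_i x (x) F_i^(n-1) w if F_i can act on x.  Hence the matrix entries
   of F_1^(a) F_2^(b) F_1^(c) can be computed by stripping off columns from the left.
   The special tableau consists of columns (3)^t, (2)^(k-t), (1)^m, (1,3)^(b-t), (1,2)^n.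
   Only a column (2) can be reached in two ways (in the first or in the last application of
   F_1); the resulting recursion is the Pascal rule for q-binomials, and all other columns
   contribute trivially. *)

theory Submission
  imports Defs
begin

section \<open>Linearity\<close>

lemma lookup_scale [simp]: "Poly_Mapping.lookup (scale c u) x = c * Poly_Mapping.lookup u x"
  by (simp add: scale_def Poly_Mapping.map.rep_eq when_def)

lemma lookup_basis: "Poly_Mapping.lookup (basis x) y = (if x = y then 1 else 0)"
  by (simp add: basis_def lookup_single when_def)

text \<open>Summing over any finite \<open>A\<close> containing the support lets vectors with
  different supports be compared over one index set.\<close>

lemma lookup_lin_ext:
  assumes "finite A" "Poly_Mapping.keys u \<subseteq> A"
  shows "Poly_Mapping.lookup (lin_ext f u) y =
    (\<Sum>x\<in>A. Poly_Mapping.lookup u x * Poly_Mapping.lookup (f x) y)"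
  unfolding lin_ext_def lookup_sum lookup_scale
  by (rule sum.mono_neutral_left) (use assms in \<open>auto simp: in_keys_iff\<close>)

lemma scale_add_right: "scale c (u + v) = scale c u + scale c v"
  by (rule poly_mapping_eqI) (simp add: lookup_add algebra_simps)

lemma scale_scale [simp]: "scale c (scale d u) = scale (c * d) u"
  by (rule poly_mapping_eqI) simp

lemma scale_one [simp]: "scale 1 u = u"
  by (rule poly_mapping_eqI) simp

lemma scale_zero_right [simp]: "scale c 0 = 0"
  by (rule poly_mapping_eqI) simp

lemma scale_add_left: "scale (c + d) u = scale c u + scale d u"
  by (rule poly_mapping_eqI) (simp add: lookup_add algebra_simps)

lemma lin_ext_zero [simp]: "lin_ext f 0 = 0"
  by (simp add: lin_ext_def)

lemma lin_ext_add: "lin_ext f (u + v) = lin_ext f u + lin_ext f v"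
proof (rule poly_mapping_eqI)
  fix y
  let ?A = "Poly_Mapping.keys u \<union> Poly_Mapping.keys v"
  have "Poly_Mapping.keys (u + v) \<subseteq> ?A" by (rule Poly_Mapping.keys_add)
  then show "Poly_Mapping.lookup (lin_ext f (u + v)) y = Poly_Mapping.lookup (lin_ext f u + lin_ext f v) y"
    by (simp add: lookup_lin_ext[where A = ?A] lookup_add sum.distrib algebra_simps)
qed

lemma lin_ext_scale: "lin_ext f (scale c u) = scale c (lin_ext f u)"
proof (rule poly_mapping_eqI)
  fix y
  have "Poly_Mapping.keys (scale c u) \<subseteq> Poly_Mapping.keys u" by (auto simp: in_keys_iff)
  then show "Poly_Mapping.lookup (lin_ext f (scale c u)) y = Poly_Mapping.lookup (scale c (lin_ext f u)) y"
    by (simp add: lookup_lin_ext[where A = "Poly_Mapping.keys u"] sum_distrib_left algebra_simps)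
qed

lemma lin_ext_basis [simp]: "lin_ext f (basis x) = f x"
  by (simp add: lin_ext_def basis_def)

lemma lin_ext_fun_add: "lin_ext (\<lambda>x. f x + g x) u = lin_ext f u + lin_ext g u"
  by (simp add: lin_ext_def scale_add_right sum.distrib)

lemma lin_ext_sum: "lin_ext g (\<Sum>x\<in>A. h x) = (\<Sum>x\<in>A. lin_ext g (h x))"
  by (induction A rule: infinite_finite_induct) (auto simp: lin_ext_add)

lemma lin_ext_lin_ext: "lin_ext g (lin_ext f u) = lin_ext (\<lambda>x. lin_ext g (f x)) u"
  by (simp add: lin_ext_def[of _ u] lin_ext_sum lin_ext_scale)

section \<open>Tensoring with a single column, and linearity of the operators\<close>

lemma tensor_basis: "tensor (basis x) w = lin_ext (\<lambda>xs. basis (x # xs)) w"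
  by (simp add: tensor_def)

text \<open>This is what strips a column: reading off a coefficient selects the terms whose leading
  column is the prescribed one.\<close>

lemma lookup_tensor_basis:
  "Poly_Mapping.lookup (tensor (basis x) w) (y # ys) = (if x = y then Poly_Mapping.lookup w ys else 0)"
  by (auto simp: tensor_basis lookup_lin_ext[OF finite_keys order_refl] lookup_basis in_keys_iff
      if_distrib[of "(*) _"] cong: if_cong)

lemma tensor_scale_left: "tensor (scale c u) w = scale c (tensor u w)"
  by (simp add: tensor_def lin_ext_scale)

lemma tensor_zero_left [simp]: "tensor 0 w = 0"
  by (simp add: tensor_def)

lemma tensor_basis_scale: "tensor (basis x) (scale c w) = scale c (tensor (basis x) w)"
  by (simp add: tensor_basis lin_ext_scale)

lemma lin_ext_fun_scale: "lin_ext (\<lambda>x. scale c (f x)) u = scale c (lin_ext f u)"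
  by (rule poly_mapping_eqI)
     (simp add: lookup_lin_ext[OF finite_keys order_refl] sum_distrib_left mult.left_commute)

lemma F_add: "F i (u + v) = F i u + F i v"
  by (simp add: F_def lin_ext_add)

lemma F_scale: "F i (scale c u) = scale c (F i u)"
  by (simp add: F_def lin_ext_scale)

lemma F_funpow_add: "(F i ^^ n) (u + v) = (F i ^^ n) u + (F i ^^ n) v"
  by (induction n) (auto simp: F_add)

lemma F_funpow_scale: "(F i ^^ n) (scale c u) = scale c ((F i ^^ n) u)"
  by (induction n) (auto simp: F_scale)

lemma F_div_add: "F_div i n (u + v) = F_div i n u + F_div i n v"
  by (simp add: F_div_def F_funpow_add scale_add_right)

lemma F_div_scale: "F_div i n (scale c u) = scale c (F_div i n u)"
  by (simp add: F_div_def F_funpow_scale mult.commute)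

lemma F_div_zero [simp]: "F_div i n 0 = 0"
proof -
  have "scale 0 u = 0" for u :: "tableau \<Rightarrow>\<^sub>0 ratfun"
    by (rule poly_mapping_eqI) simp
  then show ?thesis
    using F_div_scale[of i n 0 0] by simp
qed

text \<open>Extends the comultiplication rule defining \<open>F_tab\<close> by linearity, so that
  the right factor may be any vector and \<open>F i\<close> can be iterated.\<close>

lemma F_tensor_basis:
  "F i (tensor (basis x) w) = tensor (F_col i x) w + tensor (K_col i x) (F i w)"
proof -
  have "F i (tensor (basis x) w) =
      lin_ext (\<lambda>xs. tensor (F_col i x) (basis xs) + tensor (K_col i x) (F_tab i xs)) w"
    by (simp add: F_def tensor_basis lin_ext_lin_ext)
  also have "\<dots> = lin_ext (\<lambda>xs. tensor (F_col i x) (basis xs)) w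
      + lin_ext (\<lambda>xs. tensor (K_col i x) (F_tab i xs)) w"
    by (rule lin_ext_fun_add)
  also have "lin_ext (\<lambda>xs. tensor (F_col i x) (basis xs)) w = tensor (F_col i x) w"
    by (simp add: F_col_def tensor_basis) (simp add: lin_ext_def)
  also have "lin_ext (\<lambda>xs. tensor (K_col i x) (F_tab i xs)) w = tensor (K_col i x) (F i w)"
    by (simp add: K_col_def tensor_scale_left tensor_basis F_def lin_ext_lin_ext lin_ext_fun_scale)
  finally show ?thesis .
qed


section \<open>Quantum integers\<close>

lemma q_power: "q ^ n = Fract (monom 1 n) 1"
  by (induction n) (auto simp: q_def One_fract_def monom_Suc)

lemma q_nonzero [simp]: "q \<noteq> 0"
  by (simp add: q_def Zero_fract_def eq_fract)

text \<open>Comparing degrees of numerators shows that \<open>q\<close> is not a root of unity;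
  hence \<open>qint n\<close> and \<open>qfact n\<close> can be divided by.\<close>

lemma q_power_neq_one: "n > 0 \<Longrightarrow> q ^ n \<noteq> 1"
  by (auto simp: q_power One_fract_def eq_fract dest: arg_cong[where f = degree] simp: degree_monom_eq)

lemma q_minus_inverse: "q - inverse q \<noteq> 0"
  using q_power_neq_one[of 2] by (auto simp: field_simps power2_eq_square)

lemma qint_nonzero: "n > 0 \<Longrightarrow> qint n \<noteq> 0"
proof
  assume "n > 0" and "qint n = 0"
  then have "q ^ n = inverse q ^ n"
    using q_minus_inverse by (simp add: qint_def)
  then have "q ^ n * q ^ n = 1"
    by (simp add: field_simps)
  then show False
    using q_power_neq_one[of "n + n"] \<open>n > 0\<close> by (simp add: power_add)
qed

lemma qfact_Suc: "qfact (Suc n) = qint (Suc n) * qfact n"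
  by (simp add: qfact_def mult.commute)

lemma qfact_0 [simp]: "qfact 0 = 1"
  by (simp add: qfact_def)

lemma qfact_nonzero [simp]: "qfact n \<noteq> 0"
  by (simp add: qfact_def qint_nonzero)

lemma qint_0 [simp]: "qint 0 = 0"
  by (simp add: qint_def)

lemma qint_add: "qint (a + c) = q ^ c * qint a + inverse q ^ a * qint c"
proof -
  have "q ^ (a + c) - inverse q ^ (a + c) =
      q ^ c * (q ^ a - inverse q ^ a) + inverse q ^ a * (q ^ c - inverse q ^ c)"
    by (simp add: algebra_simps power_add)
  then show ?thesis
    by (simp only: qint_def add_divide_distrib times_divide_eq_right)
qed

text \<open>Mirrors one more application of \<open>F i\<close>: raising the column now contributes
  \<open>q ^ n\<close>, while passing a column already raised contributes
  \<open>inverse q\<close>.\<close>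

lemma qint_Suc: "qint (Suc n) = q ^ n + inverse q * qint n"
proof -
  have "qint 1 = 1"
    using q_minus_inverse by (simp add: qint_def)
  then show ?thesis
    using qint_add[of 1 n] by simp
qed

lemma qbinom_0 [simp]: "qbinom n 0 = 1"
  by (simp add: qbinom_def)

lemma qbinom_self [simp]: "qbinom n n = 1"
  by (simp add: qbinom_def)

text \<open>Of the two Pascal rules, this one has the exponents of the recursion for a column (2).
  Successors avoid truncated subtraction.\<close>

lemma qbinom_Pascal:
  "qbinom (Suc a + Suc c) (Suc c) =
    q ^ Suc c * qbinom (a + Suc c) (Suc c) + inverse q ^ Suc a * qbinom (Suc a + c) c"
proof -
  have "qbinom (Suc a + Suc c) (Suc c) = qint (Suc a + Suc c) * qfact (a + Suc c) / (qfact (Suc c) * qfact (Suc a))"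
    by (simp add: qbinom_def qfact_Suc)
  also have "\<dots> = q ^ Suc c * (qint (Suc a) * qfact (a + Suc c) / (qfact (Suc c) * qfact (Suc a)))
      + inverse q ^ Suc a * (qint (Suc c) * qfact (a + Suc c) / (qfact (Suc c) * qfact (Suc a)))"
    unfolding qint_add by (simp add: field_simps)
  also have "qint (Suc a) * qfact (a + Suc c) / (qfact (Suc c) * qfact (Suc a)) = qbinom (a + Suc c) (Suc c)"
    by (simp add: qbinom_def qfact_Suc[of a] qint_nonzero)
  also have "qint (Suc c) * qfact (a + Suc c) / (qfact (Suc c) * qfact (Suc a)) = qbinom (Suc a + c) c"
    by (simp add: qbinom_def qfact_Suc[of c] qint_nonzero)
  finally show ?thesis .
qed


section \<open>Divided powers on a tensor product\<close>

definition raised :: "nat \<Rightarrow> col \<Rightarrow> col" where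
  "raised i x = map (\<lambda>y. if y = i then i + 1 else y) x"

text \<open>Here \<open>F \<otimes> 1\<close> and \<open>K \<otimes> F\<close> commute up to \<open>q\<^sup>2\<close> and \<open>F\<^sup>2\<close> kills a column, so
  \<open>F\<^sup>n\<close> produces the factor \<open>qint n\<close>, which the divided power removes.\<close>

lemma F_div_tensor_movable:
  assumes "i \<in> set x" "i + 1 \<notin> set x"
  shows "F_div i n (tensor (basis x) w) =
    scale (q ^ n) (tensor (basis x) (F_div i n w)) +
    (if n = 0 then 0 else tensor (basis (raised i x)) (F_div i (n - 1) w))"
proof -
  have K: "K_col i x = scale q (basis x)" "F_col i x = basis (raised i x)"
    using assms by (simp_all add: K_col_def F_col_def raised_def)
  \<comment> \<open>A raised column is killed by \<open>F i\<close>, so at most one factor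
    \<open>F i\<close> is spent on it.\<close>
  have K': "K_col i (raised i x) = scale (inverse q) (basis (raised i x))" "F_col i (raised i x) = 0"
    using assms by (auto simp: K_col_def F_col_def raised_def)
  have "(F i ^^ n) (tensor (basis x) w) =
      scale (q ^ n) (tensor (basis x) ((F i ^^ n) w)) +
      scale (qint n) (tensor (basis (raised i x)) ((F i ^^ (n - 1)) w))"
  proof (induction n)
    case 0
    show ?case by (auto intro: poly_mapping_eqI simp: lookup_add)
  next
    case (Suc n)
    \<comment> \<open>For \<open>n = 0\<close> the truncated \<open>n - 1\<close> makes the two
      vectors differ, but \<open>qint 0 = 0\<close> annihilates both.\<close>
    have low: "scale (qint n) (tensor (basis (raised i x)) (F i ((F i ^^ (n - 1)) w))) =
        scale (qint n) (tensor (basis (raised i x)) ((F i ^^ n) w))"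
      by (cases n) (auto intro: poly_mapping_eqI)
    have "(F i ^^ Suc n) (tensor (basis x) w) =
        scale (q ^ n) (tensor (basis (raised i x)) ((F i ^^ n) w)) +
        scale (q ^ Suc n) (tensor (basis x) ((F i ^^ Suc n) w)) +
        scale (inverse q) (scale (qint n) (tensor (basis (raised i x)) (F i ((F i ^^ (n - 1)) w))))"
      by (simp add: Suc F_add F_scale F_tensor_basis K K' tensor_scale_left scale_add_right mult.commute)
    then show ?case
      unfolding low by (simp add: qint_Suc scale_add_left ac_simps)
  qed
  then show ?thesis
    by (cases n) (auto simp: F_div_def scale_add_right tensor_basis_scale qfact_Suc qint_nonzero mult.commute)
qed

lemma F_div_tensor_fixed:
  assumes "\<not> (i \<in> set x \<and> i + 1 \<notin> set x)"
  shows "F_div i n (tensor (basis x) w) =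
    scale ((if i + 1 \<in> set x \<and> i \<notin> set x then inverse q else 1) ^ n) (tensor (basis x) (F_div i n w))"
proof -
  let ?k = "if i + 1 \<in> set x \<and> i \<notin> set x then inverse q else 1"
  have K: "K_col i x = scale ?k (basis x)" "F_col i x = 0"
    using assms by (auto simp: K_col_def F_col_def)
  have "(F i ^^ n) (tensor (basis x) w) = scale (?k ^ n) (tensor (basis x) ((F i ^^ n) w))"
    by (induction n) (simp_all add: F_scale F_tensor_basis K tensor_scale_left mult.commute)
  then show ?thesis
    by (simp add: F_div_def tensor_basis_scale mult.commute)
qed

section \<open>Recursions for matrix entries, one column at a time\<close>

text \<open>Arbitrary column lists replace the highest weight vector and \<open>theta\<close>, so
  that stripping a column gives an entry of the same kind.\<close>

definition N :: "nat \<Rightarrow> nat \<Rightarrow> nat \<Rightarrow> tableau \<Rightarrow> tableau \<Rightarrow> ratfun" where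
  "N a b c X Y = Poly_Mapping.lookup (F_div 1 a (F_div 2 b (F_div 1 c (basis X)))) Y"

lemmas F_div_simps = F_div_add F_div_scale F_div_tensor_movable F_div_tensor_fixed raised_def

lemma basis_Cons: "basis (x # xs) = tensor (basis x) (basis xs)"
  by (simp add: tensor_basis)

text \<open>The column must be raised by the first \<open>F_1\<close> power and then by the
  \<open>F_2\<close> power; the last \<open>F_1\<close> power fixes (3) with factor 1.\<close>

lemma N_3: "N a (Suc b) (Suc c) ([1] # X) ([3] # Y) = N a b c X Y"
  by (simp add: N_def basis_Cons F_div_simps lookup_add lookup_tensor_basis)

lemma N_1: "N a b c ([1] # X) ([1] # Y) = q ^ (a + c) * N a b c X Y"
  by (simp add: N_def basis_Cons F_div_simps lookup_add lookup_tensor_basis power_add)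

text \<open>The first term raises the column in the last \<open>F_1\<close> power, after the factor
  \<open>q ^ c\<close> from the first. The second raises it in the first \<open>F_1\<close> power;
  the resulting (2) then contributes \<open>q ^ b\<close> and \<open>inverse q ^ a\<close>.\<close>

lemma N_2: "N a b c ([1] # X) ([2] # Y) =
   (if a = 0 then 0 else q ^ c * N (a - 1) b c X Y) +
   (if c = 0 then 0 else q ^ b * inverse q ^ a * N a b (c - 1) X Y)"
  by (simp add: N_def basis_Cons F_div_simps lookup_add lookup_tensor_basis)

lemma N_13: "N a (Suc b) c ([1, 2] # X) ([1, 3] # Y) = q ^ a * N a b c X Y"
  by (simp add: N_def basis_Cons F_div_simps lookup_add lookup_tensor_basis)

lemma N_3s: "N a (t + b) (t + c) (replicate t [1] @ X) (replicate t [3] @ Y) = N a b c X Y"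
  by (induction t) (simp_all add: N_3 del: One_nat_def)

text \<open>Without powers of \<open>F_1\<close> every column (1) or (1,3) contributes 1, and the
  columns (1,3) use up the whole power of \<open>F_2\<close>.\<close>

lemma N_tail:
  "N 0 b 0 (replicate m [1] @ replicate (b + n) [1, 2])
     (replicate m [1] @ replicate b [1, 3] @ replicate n [1, 2]) = 1"
proof -
  have "N 0 0 0 (replicate n [1, 2]) (replicate n [1, 2]) = 1"
    by (simp add: N_def F_div_def lookup_basis)
  then have "N 0 b 0 (replicate (b + n) [1, 2]) (replicate b [1, 3] @ replicate n [1, 2]) = 1"
    by (induction b) (simp_all add: N_13 del: One_nat_def)
  then show ?thesis
    by (induction m) (simp_all add: N_1 del: One_nat_def)
qed

lemma N_2s:
  assumes "N 0 b 0 X Y = 1"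
  shows "N a b c (replicate (a + c) [1] @ X) (replicate (a + c) [2] @ Y) =
    q ^ (c * b) * qbinom (a + c) c"
proof (induction "a + c" arbitrary: a c)
  case 0
  then show ?case using assms by simp
next
  case (Suc n)
  show ?case
  proof (cases a)
    case 0
    then obtain c' where "c = Suc c'" using Suc by (cases c) auto
    then show ?thesis using Suc(1)[of 0 c'] Suc(2) 0 by (simp add: N_2 power_add del: One_nat_def)
  next
    case a: (Suc a')
    show ?thesis
    proof (cases c)
      case 0
      then show ?thesis using Suc(1)[of a' 0] Suc(2) a by (simp add: N_2 del: One_nat_def)
    next
      case c: (Suc c')
      have "N a b c (replicate (a + c) [1] @ X) (replicate (a + c) [2] @ Y)
        = q ^ c * N a' b c (replicate n [1] @ X) (replicate n [2] @ Y)
          + q ^ b * inverse q ^ a * N a b c' (replicate n [1] @ X) (replicate n [2] @ Y)"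
        unfolding Suc(2)[symmetric] replicate_Suc append_Cons N_2 using a c by simp
      also have "\<dots> = q ^ c * (q ^ (c * b) * qbinom (a' + c) c)
          + q ^ b * inverse q ^ a * (q ^ (c' * b) * qbinom (a + c') c')"
        using Suc(1)[of a' c] Suc(1)[of a c'] Suc(2) a c by simp
      \<comment> \<open>Both terms share \<open>q ^ (c * b)\<close>: each of the \<open>c\<close>
        columns raised early accounts for one \<open>q ^ b\<close>. The bracket is the Pascal
        rule.\<close>
      also have "\<dots> = q ^ (c * b) * (q ^ c * qbinom (a' + c) c + inverse q ^ a * qbinom (a + c') c')"
        by (simp add: c power_add algebra_simps)
      also have "\<dots> = q ^ (c * b) * qbinom (a + c) c"
        unfolding a c by (simp only: qbinom_Pascal)
      finally show ?thesis .
    qed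
  qed
qed


section \<open>Special standard tableaux\<close>

text \<open>As a pairwise relation on columns, standardness can be checked block by block on
  concatenations.\<close>

lemma standard_iff:
  "standard T \<longleftrightarrow> sorted_wrt (\<lambda>x y. \<forall>r. r < length x \<and> r < length y \<longrightarrow> y ! r \<le> x ! r) T"
  unfolding standard_def sorted_wrt_iff_nth_less by blast

lemma sorted_wrt_replicate: "P x x \<Longrightarrow> sorted_wrt P (replicate n x)"
  by (induction n) auto

lemma count_list_conv_filter: "count_list xs x = length (filter (\<lambda>y. y = x) xs)"
  by (induction xs) auto

lemma assoc_monomial_eq:
  "assoc_monomial T =
    (length (filter (\<lambda>x. x ! 0 = 2) T), sum_list (map (\<lambda>x. count_list x 3) T),
     length (filter (\<lambda>x. x ! 0 = 3) T))"
proof -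
  have "{(i, r). i < length T \<and> r < length (T ! i) \<and> T ! i ! r = 3} =
      Sigma {..<length T} (\<lambda>i. {r. r < length (T ! i) \<and> T ! i ! r = 3})"
    by auto
  then have "card {(i, r). i < length T \<and> r < length (T ! i) \<and> T ! i ! r = 3} =
      (\<Sum>i<length T. count_list (T ! i) 3)"
    by (simp add: count_list_conv_filter length_filter_conv_card)
  also have "\<dots> = sum_list (map (\<lambda>x. count_list x 3) T)"
    by (simp add: sum_list_sum_nth atLeast0LessThan)
  finally show ?thesis
    by (simp add: assoc_monomial_def length_filter_conv_card)
qed

text \<open>A non-increasing word in 1, 2, 3 is determined by its length and its numbers of 3's and
  2's.\<close>

lemma decreasing_123:
  fixes xs :: "nat list"
  assumes "sorted_wrt (\<ge>) xs" "set xs \<subseteq> {1, 2, 3}"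
  shows "xs = replicate (count_list xs 3) 3 @ replicate (count_list xs 2) 2 @
    replicate (length xs - (count_list xs 3 + count_list xs 2)) 1"
  using assms
proof (induction xs)
  case (Cons x xs)
  consider "x = 3" | "x = 2" | "x = 1" using Cons.prems by auto
  then show ?case
  proof cases
    case 1
    then show ?thesis using Cons by simp
  next
    case 2
    then have "3 \<notin> set xs" using Cons.prems by auto
    then have "count_list xs 3 = 0" by simp
    then show ?thesis using Cons 2 by simp
  next
    case 3
    then have "3 \<notin> set xs" "2 \<notin> set xs" using Cons.prems by auto
    then have "count_list xs 3 = 0" "count_list xs 2 = 0" by simp_all
    then show ?thesis using Cons 3 by simp
  qed
qed simp

text \<open>Uniqueness: a two-box column of a special tableau has 1 on top, so only two
  non-increasing words remain, the one-box entries and the second row. The monomial fixes their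
  letter counts.\<close>

lemma special_standard_eq:
  assumes T: "is_tableau (m1, m2) T" "standard T" "special T" and mon: "assoc_monomial T = (a, b, c)"
  shows "T = replicate c [3] @ replicate a [2] @ replicate (m1 - (a + c)) [1] @
    replicate (b - c) [1, 3] @ replicate (m2 - (b - c)) [1, 2]"
proof -
  define xs where "xs = map (\<lambda>x. x ! 0) (take m1 T)"
  define ys where "ys = map (\<lambda>x. x ! 1) (drop m1 T)"
  have len: "length T = m1 + m2"
    and cols: "\<And>i. i < m1 + m2 \<Longrightarrow> length (T ! i) = (if i < m1 then 1 else 2)"
    and entries: "\<And>x. x \<in> set T \<Longrightarrow> set x \<subseteq> {1, 2, 3} \<and> sorted_wrt (<) x"
    using T(1) by (auto simp: is_tableau_def)
  have [simp]: "length xs = m1" "length ys = m2"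
    using len by (simp_all add: xs_def ys_def)
  have single: "\<exists>e\<in>{1, 2, 3}. x = [e]" if x: "x \<in> set (take m1 T)" for x
  proof -
    obtain i where "i < m1" "x = T ! i" using x len by (auto simp: in_set_conv_nth)
    then have "length x = 1" using cols[of i] by simp
    then obtain e where "x = [e]" by (auto simp: length_Suc_conv)
    then show ?thesis using entries[of x] in_set_takeD[OF x] by auto
  qed
  have double: "\<exists>e\<in>{2, 3}. x = [1, e]" if x: "x \<in> set (drop m1 T)" for x
  proof -
    obtain i where "i < m2" "x = T ! (m1 + i)" using x len by (auto simp: in_set_conv_nth)
    then have "length x = 2" using cols[of "m1 + i"] by simp
    then obtain d e where x': "x = [d, e]" by (auto simp: length_Suc_conv numeral_2_eq_2)
    have xT: "x \<in> set T" using in_set_dropD[OF x] .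
    \<comment> \<open>The top box is not the last of its column, so specialness bounds its entry by
      1.\<close>
    have "\<not> d > 1" using T(3) xT x' unfolding special_def by force
    then show ?thesis using entries[OF xT] x' by auto
  qed
  have "take m1 T = map (\<lambda>e. [e]) xs"
    unfolding xs_def map_map by (rule sym, rule map_idI) (use single in force)
  moreover have "drop m1 T = map (\<lambda>e. [1, e]) ys"
    unfolding ys_def map_map by (rule sym, rule map_idI) (use double in force)
  ultimately have eq: "T = map (\<lambda>e. [e]) xs @ map (\<lambda>e. [1, e]) ys"
    by (metis append_take_drop_id)
  have xs: "set xs \<subseteq> {1, 2, 3}" and ys: "set ys \<subseteq> {2, 3}"
    using single double by (fastforce simp: xs_def ys_def)+
  have "sorted_wrt (\<ge>) xs"
    using T(2) by (simp add: standard_iff eq sorted_wrt_append sorted_wrt_map)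
  moreover have "sorted_wrt (\<lambda>d e. \<forall>r<2. [1, e] ! r \<le> [1, d] ! r) ys"
    using T(2) by (simp add: standard_iff eq sorted_wrt_append sorted_wrt_map numeral_2_eq_2)
  then have "sorted_wrt (\<ge>) ys"
    by (rule sorted_wrt_mono_rel[rotated]) (auto simp: numeral_2_eq_2 All_less_Suc)
  ultimately have
    xs_eq: "xs = replicate (count_list xs 3) 3 @ replicate (count_list xs 2) 2 @
      replicate (m1 - (count_list xs 3 + count_list xs 2)) 1" and
    ys_eq: "ys = replicate (count_list ys 3) 3 @ replicate (count_list ys 2) 2 @
      replicate (m2 - (count_list ys 3 + count_list ys 2)) 1"
    using decreasing_123[of xs] decreasing_123[of ys] xs ys by auto
  have "a = count_list xs 2" "c = count_list xs 3"
    using mon by (simp_all add: assoc_monomial_eq eq filter_map o_def count_list_conv_filter)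
  moreover have "b = count_list xs 3 + count_list ys 3"
  proof -
    have "sum_list (map (\<lambda>x. count_list x 3) (map (\<lambda>e. [e]) zs)) = count_list zs 3"
      "sum_list (map (\<lambda>x. count_list x 3) (map (\<lambda>e. [1, e]) zs)) = count_list zs 3" for zs :: "nat list"
      by (induction zs) auto
    then show ?thesis
      using mon by (simp add: assoc_monomial_eq eq del: map_map One_nat_def)
  qed
  ultimately have ca: "count_list xs 2 = a" and cc: "count_list xs 3 = c" and cb: "count_list ys 3 = b - c"
    by simp_all
  \<comment> \<open>No 1 occurs in the second row, so the block of 1's in \<open>ys_eq\<close> is
    empty.\<close>
  have "count_list ys 3 + count_list ys 2 = m2"
    using \<open>length ys = m2\<close> ys by (induction ys arbitrary: m2) auto
  then have "ys = replicate (b - c) 3 @ replicate (m2 - (b - c)) 2"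
    using ys_eq cb by (metis append_Nil2 diff_add_inverse diff_self_eq_0 replicate_0)
  moreover have "xs = replicate c 3 @ replicate a 2 @ replicate (m1 - (a + c)) 1"
    using xs_eq ca cc by (simp add: add.commute)
  ultimately show ?thesis
    unfolding eq by (simp add: map_replicate)
qed

text \<open>The size bounds make the block lengths add up to \<open>m1\<close> and
  \<open>m2\<close>, giving existence; uniqueness then evaluates the description.\<close>

lemma theta_eq:
  assumes "c \<le> b" "a + c \<le> m1" "b - c \<le> m2"
  shows "theta (m1, m2) (a, b, c) = replicate c [3] @ replicate a [2] @ replicate (m1 - (a + c)) [1] @
    replicate (b - c) [1, 3] @ replicate (m2 - (b - c)) [1, 2]" (is "_ = ?T")
  unfolding theta_def
proof (rule the_equality)
  have "is_tableau (m1, m2) ?T"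
    using assms by (auto simp: is_tableau_def nth_append)
  moreover have "standard ?T"
    by (auto simp: standard_iff sorted_wrt_append sorted_wrt_replicate nth_Cons')
  moreover have "special ?T"
    by (auto simp: special_def nth_Cons' split: if_splits)
  moreover have "assoc_monomial ?T = (a, b, c)"
    using assms by (simp add: assoc_monomial_eq sum_list_replicate)
  ultimately show "is_tableau (m1, m2) ?T \<and> standard ?T \<and> special ?T \<and> assoc_monomial ?T = (a, b, c)"
    by blast
next
  fix T
  assume "is_tableau (m1, m2) T \<and> standard T \<and> special T \<and> assoc_monomial T = (a, b, c)"
  then show "T = ?T"
    by (elim conjE) (rule special_standard_eq)
qed


theorem proposition6p1:
  fixes b k s t :: nat and lam :: shape
  assumes "t \<le> s" and "s \<le> min b k"
    and "large_enough lam (k - s, b, s)"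
    and "large_enough lam (k - t, b, t)"
  shows "n_coeff lam (k - t, b, t) (k - s, b, s) = q ^ ((s - t) * (b - t)) * qbinom (k - t) (s - t)"
proof -
  obtain m1 m2 where lam: "lam = (m1, m2)" by force
  \<comment> \<open>Block lengths of \<open>theta\<close>: t columns (3), then A + C columns (2), m
    columns (1), B columns (1,3) and n columns (1,2).\<close>
  define B C A m n where "B = b - t" and "C = s - t" and "A = k - s" and "m = m1 - k" and "n = m2 - (b - t)"
  have le: "k \<le> m1" "b - t \<le> m2"
    using assms by (auto simp: large_enough_def lam)
  have b: "b = t + B" and s: "s = t + C" and k: "k - t = A + C" and
    m2: "m2 = B + n" and m1: "m1 = t + ((A + C) + m)"
    using assms le by (auto simp: B_def C_def A_def m_def n_def)
  let ?Y = "replicate m [1] @ replicate B [1, 3] @ replicate n [1, 2]"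
  have "theta lam (k - t, b, t) = replicate t [3] @ replicate (A + C) [2] @ ?Y"
    unfolding lam using assms le by (subst theta_eq) (auto simp: k m1 m2 b)
  \<comment> \<open>The highest weight vector is cut into blocks aligned with those of
    \<open>theta\<close>.\<close>
  moreover have "v_lam lam = basis (replicate t [1] @ replicate (A + C) [1] @ replicate m [1] @ replicate (B + n) [1, 2])"
    by (simp add: lam v_lam_def m1 m2 replicate_add)
  ultimately have "n_coeff lam (k - t, b, t) (k - s, b, s) =
      N A (t + B) (t + C) (replicate t [1] @ replicate (A + C) [1] @ replicate m [1] @ replicate (B + n) [1, 2])
        (replicate t [3] @ replicate (A + C) [2] @ ?Y)"
    by (simp add: n_coeff_def N_def b s flip: A_def) (simp add: A_def s)
  also have "\<dots> = q ^ (C * B) * qbinom (A + C) C"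
    \<comment> \<open>Stripping the columns (3) lowers \<open>b\<close> to \<open>B\<close> and
      \<open>s\<close> to \<open>C\<close>, which yields the exponent \<open>C * B\<close>.\<close>
    unfolding N_3s by (rule N_2s[OF N_tail])
  finally show ?thesis by (simp add: C_def B_def k)
qed

end
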